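(* Let $f: Z \to Y$ be a continuous function between compact Hausdorff spaces. Then the following are equivalent: (a) $f^*: \mathcal V(Y) \to \mathcal V(Z)$ is continuous; (b) $f^* \circ i: Y \to \mathcal V(Z)$ is continuous; (c) $f$ is open.
   Context: For a compact Hausdorff space $X$, the Vietoris space $\mathcal V(X)$ is the set of all closed subsets of $X$ (including $\emptyset$), with the topology generated by the sets $\Diamond U = \{C \in \mathcal V(X) \mid C \cap U \neq \emptyset\}$ and $\Box U = \{C \in \mathcal V(X) \mid C \subseteq U\}$, where $U$ ranges over all open subsets of $X$. For a continuous map $f: Z \to Y$, $f^*: \mathcal V(Y) \to \mathcal V(Z)$ denotes the inverse image map $C \mapsto f^{-1}(C)$. The map $i = i_Y: Y \to \mathcal V(Y)$ is $y \mapsto \{y\}$. *)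

theory Defs
  imports "HOL-Analysis.Analysis"
begin

definition vietoris_diamond :: "'a topology \<Rightarrow> 'a set \<Rightarrow> 'a set set" where
  "vietoris_diamond X U = {C. closedin X C \<and> C \<inter> U \<noteq> {}}"

definition vietoris_box :: "'a topology \<Rightarrow> 'a set \<Rightarrow> 'a set set" where
  "vietoris_box X U = {C. closedin X C \<and> C \<subseteq> U}"

definition vietoris :: "'a topology \<Rightarrow> 'a set topology" where
  "vietoris X = topology_generated_by
     (vietoris_diamond X ` {U. openin X U} \<union> vietoris_box X ` {U. openin X U})"

lemma topspace_vietoris: "topspace (vietoris X) = {C. closedin X C}"
proof
  show "topspace (vietoris X) \<subseteq> {C. closedin X C}"
    by (auto simp: vietoris_def vietoris_diamond_def vietoris_box_def)
  have "{C. closedin X C} = vietoris_box X (topspace X)"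
    by (auto simp: vietoris_box_def dest: closedin_subset)
  then show "{C. closedin X C} \<subseteq> topspace (vietoris X)"
    by (auto simp: vietoris_def)
qed

text \<open>Maps between spaces are total functions on the underlying types, so the preimage is
  cut down to the carrier of the domain \<open>Z\<close>.\<close>

definition inverse_image_map :: "'b topology \<Rightarrow> ('b \<Rightarrow> 'a) \<Rightarrow> 'a set \<Rightarrow> 'b set" where
  "inverse_image_map Z f C = {z \<in> topspace Z. f z \<in> C}"

definition singleton_map :: "'a \<Rightarrow> 'a set" where
  "singleton_map y = {y}"

end

theory Submission
  imports Defs
begin

text \<open>The preimage of \<open>\<diamond>U\<close> under \<open>f\<^sup>* \<circ> i\<close> is \<open>f ` U\<close>, so continuity of \<open>f\<^sup>* \<circ> i\<close> forces
  \<open>f\<close> to be open. Conversely, \<open>f\<^sup>*\<close> pulls \<open>\<diamond>U\<close> back to \<open>\<diamond>(f ` U)\<close> and \<open>\<box>U\<close> back to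
  \<open>\<box>(Y - f ` (Z - U))\<close>; the latter is always open because \<open>f\<close> is a closed map.\<close>

lemma openin_vietoris_diamond: "openin X U \<Longrightarrow> openin (vietoris X) (vietoris_diamond X U)"
  unfolding vietoris_def by (intro topology_generated_by_Basis) auto

lemma openin_vietoris_box: "openin X U \<Longrightarrow> openin (vietoris X) (vietoris_box X U)"
  unfolding vietoris_def by (intro topology_generated_by_Basis) auto

text \<open>As \<open>vietoris X\<close> is generated by diamonds and boxes, only their preimages
  need to be open. The first premise puts the values of \<open>g\<close> in the carrier and
  discharges the closedness clause built into both kinds of generator.\<close>

lemma continuous_map_vietorisI:
  assumes "\<And>x. x \<in> topspace T \<Longrightarrow> closedin X (g x)"
    and "\<And>U. openin X U \<Longrightarrow> openin T {x \<in> topspace T. g x \<inter> U \<noteq> {}}"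
    and "\<And>U. openin X U \<Longrightarrow> openin T {x \<in> topspace T. g x \<subseteq> U}"
  shows "continuous_map T (vietoris X) g"
proof -
  have "g -` vietoris_diamond X U \<inter> topspace T = {x \<in> topspace T. g x \<inter> U \<noteq> {}}"
    and "g -` vietoris_box X U \<inter> topspace T = {x \<in> topspace T. g x \<subseteq> U}" for U
    using assms(1) by (auto simp: vietoris_diamond_def vietoris_box_def)
  moreover have "g ` topspace T \<subseteq> topspace (vietoris X)"
    using assms(1) by (auto simp: topspace_vietoris)
  ultimately show ?thesis
    using assms(2,3) unfolding vietoris_def continuous_on_generated_topo_iff
    by auto
qed

text \<open>A singleton meets U exactly when it is contained in U, so the diamond and the box of U
  both pull back to U. The T1 axiom makes singletons points of the Vietoris space.\<close>

lemma continuous_map_singleton_map: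
  assumes "t1_space Y"
  shows "continuous_map Y (vietoris Y) singleton_map"
proof (rule continuous_map_vietorisI)
  show "closedin Y (singleton_map y)" if "y \<in> topspace Y" for y
    using assms that by (simp add: singleton_map_def t1_space_closedin_singleton)
next
  fix U assume "openin Y U"
  moreover from this have "{y \<in> topspace Y. singleton_map y \<inter> U \<noteq> {}} = U"
    and "{y \<in> topspace Y. singleton_map y \<subseteq> U} = U"
    by (auto simp: singleton_map_def dest: openin_subset)
  ultimately show "openin Y {y \<in> topspace Y. singleton_map y \<inter> U \<noteq> {}}"
    and "openin Y {y \<in> topspace Y. singleton_map y \<subseteq> U}"
    by simp_all
qed

lemma open_map_if_continuous_fibre_map:
  assumes f: "f \<in> topspace Z \<rightarrow> topspace Y"
    and cont: "continuous_map Y (vietoris Z) (inverse_image_map Z f \<circ> singleton_map)"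
  shows "open_map Z Y f"
  unfolding open_map_def
proof (intro allI impI)
  fix U assume U: "openin Z U"
  let ?g = "inverse_image_map Z f \<circ> singleton_map"
  have "openin Y {y \<in> topspace Y. ?g y \<in> vietoris_diamond Z U}"
    using cont openin_vietoris_diamond[OF U] by (rule openin_continuous_map_preimage)
  \<comment> \<open>Membership in a diamond includes closedness of the fibre; this is read off from
    \<open>cont\<close>, because the points of \<open>vietoris Z\<close> are closed sets.\<close>
  moreover have "closedin Z (?g y)" if "y \<in> topspace Y" for y
    using continuous_map_funspace[OF cont] that by (auto simp: topspace_vietoris)
  then have "{y \<in> topspace Y. ?g y \<in> vietoris_diamond Z U} = f ` U"
    using f openin_subset[OF U]
    by (fastforce simp: vietoris_diamond_def inverse_image_map_def singleton_map_def)
  ultimately show "openin Y (f ` U)"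
    by simp
qed

lemma continuous_map_inverse_image_map:
  assumes f: "continuous_map Z Y f" and opn: "open_map Z Y f" and cls: "closed_map Z Y f"
  shows "continuous_map (vietoris Y) (vietoris Z) (inverse_image_map Z f)"
proof (rule continuous_map_vietorisI)
  show "closedin Z (inverse_image_map Z f C)" if "C \<in> topspace (vietoris Y)" for C
    using that f by (auto simp: topspace_vietoris inverse_image_map_def
        intro: closedin_continuous_map_preimage)
next
  fix U assume U: "openin Z U"
  have "{C \<in> topspace (vietoris Y). inverse_image_map Z f C \<inter> U \<noteq> {}}
      = vietoris_diamond Y (f ` U)"
    using openin_subset[OF U]
    by (auto simp: topspace_vietoris inverse_image_map_def vietoris_diamond_def)
  then show "openin (vietoris Y) {C \<in> topspace (vietoris Y). inverse_image_map Z f C \<inter> U \<noteq> {}}"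
    using opn U by (simp add: open_map_def openin_vietoris_diamond)
  \<comment> \<open>\<open>?V\<close> collects the points of \<open>Y\<close> whose whole fibre lies
    in \<open>U\<close>. The preimage of \<open>C\<close> stays inside \<open>U\<close> iff no point
    outside \<open>U\<close> is sent into \<open>C\<close>, that is, iff \<open>C\<close> lies in
    \<open>?V\<close>.\<close>
  let ?V = "topspace Y - f ` (topspace Z - U)"
  have "closedin Y (f ` (topspace Z - U))"
    using cls U by (auto simp: closed_map_def)
  then have "openin Y ?V"
    by auto
  moreover have "{C \<in> topspace (vietoris Y). inverse_image_map Z f C \<subseteq> U} = vietoris_box Y ?V"
    by (auto simp: topspace_vietoris inverse_image_map_def vietoris_box_def
        dest: closedin_subset)
  ultimately show "openin (vietoris Y) {C \<in> topspace (vietoris Y). inverse_image_map Z f C \<subseteq> U}"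
    by (simp add: openin_vietoris_box)
qed

theorem proposition3p1:
  fixes Z :: "'b topology" and Y :: "'a topology" and f :: "'b \<Rightarrow> 'a"
  assumes "compact_space Z" and "Hausdorff_space Z"
    and "compact_space Y" and "Hausdorff_space Y"
    and "continuous_map Z Y f"
  shows "(continuous_map (vietoris Y) (vietoris Z) (inverse_image_map Z f)
            \<longleftrightarrow> continuous_map Y (vietoris Z) (inverse_image_map Z f \<circ> singleton_map))
       \<and> (continuous_map Y (vietoris Z) (inverse_image_map Z f \<circ> singleton_map)
            \<longleftrightarrow> open_map Z Y f)"
    (is "(?a \<longleftrightarrow> ?b) \<and> (?b \<longleftrightarrow> ?c)")
proof -
  have "?a \<Longrightarrow> ?b"
    using assms(4) by (intro continuous_map_compose[of _ "vietoris Y"]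
        continuous_map_singleton_map Hausdorff_imp_t1_space)
  moreover have "?b \<Longrightarrow> ?c"
    using assms(5) by (intro open_map_if_continuous_fibre_map continuous_map_funspace)
  \<comment> \<open>Compactness of \<open>Z\<close> and the Hausdorff property of \<open>Y\<close>
    make the continuous map \<open>f\<close> closed, which handles the boxes.\<close>
  moreover have "?c \<Longrightarrow> ?a"
    using assms by (intro continuous_map_inverse_image_map continuous_imp_closed_map)
  ultimately show ?thesis
    by blast
qed

end
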